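(* Let $x_k\in\mathrm{dom}\,\psi$, $\gamma_k\in(0,1]$, and let $\bar x_{k+1}=(1-\gamma_k)x_k+\gamma_k\bar v_{k+1}$ with $\bar v_{k+1}\in\mathrm{dom}\,\psi$ satisfy $M_k(\bar x_{k+1})-M_k^*\le\xi_{k+1}$, where $\xi_{k+1}\le c\,\gamma_k^{p+1}$ for some constant $c\ge 0$. Then $$F_k(\bar x_{k+1})-F_k^*\le\delta_{k+1}\qquad\text{for}\qquad \delta_{k+1}=\bigl(c+2\Delta^{(p)}_{\mathrm{dom}\,\psi}(f)\bigr)\gamma_k^{p+1}.$$
   Context: Setting. $\mathbb{E}$ is a finite-dimensional real vector space, $\psi:\mathbb{E}\to\mathbb{R}\cup\{+\infty\}$ is a proper closed convex function with bounded domain $\mathrm{dom}\,\psi=\{x:\psi(x)<+\infty\}$, and $f$ is convex and $p\ge 1$ times continuously differentiable at every point of $\mathrm{dom}\,\psi$. $D^if(x)[h]^i$ is the $i$th directional derivative of $f$ at $x$ along $h$ (repeated $i$ times). For $y=(1-\gamma_k)x_k+\gamma_k v$ with $v\in\mathrm{dom}\,\psi$, put $S_k(y)=\gamma_k\psi\bigl(x_k+\frac1{\gamma_k}(y-x_k)\bigr)=\gamma_k\psi(v)$, $F_k(y)=f(y)+S_k(y)$, and $M_k(y)=\Omega_p(f,x_k;y)+S_k(y)$, where $$\Omega_p(f,x_k;y)=f(x_k)+\sum_{i=1}^p\frac1{i!}D^if(x_k)[y-x_k]^i .$$ $F_k^*$ and $M_k^*$ denote the global minima of $F_k(y)$ and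 $M_k(y)$ over all $y=(1-\gamma_k)x_k+\gamma_kv$, $v\in\mathrm{dom}\,\psi$. For a convex set $Q$, $$\Delta^{(p)}_Q(f)=\sup_{x,v\in Q,\;t\in(0,1]}\frac1{t^{p+1}}\Bigl|f(x+t(v-x))-f(x)-\sum_{i=1}^p\frac{t^i}{i!}D^if(x)[v-x]^i\Bigr|\in[0,+\infty]$$ (the asserted bound is void if this quantity is $+\infty$). *)

theory Defs
  imports "HOL-Analysis.Analysis"
begin

definition edom :: "('a \<Rightarrow> ereal) \<Rightarrow> 'a set" where
  "edom \<psi> = {x. \<psi> x < \<infinity>}"

definition eepi :: "('a \<Rightarrow> ereal) \<Rightarrow> ('a \<times> real) set" where
  "eepi \<psi> = {(x, r). \<psi> x \<le> ereal r}"

definition proper_closed_convex :: "('a::euclidean_space \<Rightarrow> ereal) \<Rightarrow> bool" where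
  "proper_closed_convex \<psi> \<longleftrightarrow>
     edom \<psi> \<noteq> {} \<and> (\<forall>x. \<psi> x \<noteq> -\<infinity>) \<and> closed (eepi \<psi>) \<and> convex (eepi \<psi>)"

(* Continuous differentiability of order n at a point: all derivatives up to order n exist in a
   neighbourhood of x and those of order n are continuous at x.  Derivatives of order > 1 are
   taken along fixed directions, since nested Frechet derivatives change type with the order;
   in finite dimension this is the same notion. *)
primrec cont_diff_at ::
    "nat \<Rightarrow> ('a::euclidean_space \<Rightarrow> real) \<Rightarrow> 'a \<Rightarrow> bool" where
  "cont_diff_at 0 f x \<longleftrightarrow> isCont f x"
| "cont_diff_at (Suc n) f x \<longleftrightarrow>
     (\<forall>\<^sub>F y in nhds x. f differentiable (at y)) \<and>
     (\<forall>h. cont_diff_at n (\<lambda>y. frechet_derivative f (at y) h) x)"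

(* D^i f(x)[h]^i *)
definition dir_deriv ::
    "nat \<Rightarrow> ('a::real_normed_vector \<Rightarrow> real) \<Rightarrow> 'a \<Rightarrow> 'a \<Rightarrow> real" where
  "dir_deriv i f x h = (deriv ^^ i) (\<lambda>s. f (x + s *\<^sub>R h)) 0"

definition taylor_model ::
    "nat \<Rightarrow> ('a::real_normed_vector \<Rightarrow> real) \<Rightarrow> 'a \<Rightarrow> 'a \<Rightarrow> real" where
  "taylor_model p f x y = f x + (\<Sum>i=1..p. 1 / fact i * dir_deriv i f x (y - x))"

(* Valued in [0, \<infinity>] for nonempty Q (over the empty set the supremum would be -\<infinity>). *)
definition Delta ::
    "nat \<Rightarrow> 'a::real_normed_vector set \<Rightarrow> ('a \<Rightarrow> real) \<Rightarrow> ereal" where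
  "Delta p Q f = (SUP (x, v, t) \<in> Q \<times> Q \<times> {0<..1}.
     ereal (1 / t ^ (p + 1) *
       \<bar>f (x + t *\<^sub>R (v - x)) - f x
         - (\<Sum>i=1..p. t ^ i / fact i * dir_deriv i f x (v - x))\<bar>))"

definition contracted_set ::
    "('a::real_vector \<Rightarrow> ereal) \<Rightarrow> 'a \<Rightarrow> real \<Rightarrow> 'a set" where
  "contracted_set \<psi> x \<gamma> = {(1 - \<gamma>) *\<^sub>R x + \<gamma> *\<^sub>R v |v. v \<in> edom \<psi>}"

definition S_fun ::
    "('a::real_vector \<Rightarrow> ereal) \<Rightarrow> 'a \<Rightarrow> real \<Rightarrow> 'a \<Rightarrow> ereal" where
  "S_fun \<psi> x \<gamma> y = ereal \<gamma> * \<psi> (x + (1 / \<gamma>) *\<^sub>R (y - x))"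

definition F_fun ::
    "('a::real_vector \<Rightarrow> real) \<Rightarrow> ('a \<Rightarrow> ereal) \<Rightarrow> 'a \<Rightarrow> real \<Rightarrow> 'a \<Rightarrow> ereal" where
  "F_fun f \<psi> x \<gamma> y = ereal (f y) + S_fun \<psi> x \<gamma> y"

definition M_fun ::
    "nat \<Rightarrow> ('a::real_normed_vector \<Rightarrow> real) \<Rightarrow> ('a \<Rightarrow> ereal) \<Rightarrow> 'a \<Rightarrow> real \<Rightarrow> 'a \<Rightarrow> ereal"
  where "M_fun p f \<psi> x \<gamma> y = ereal (taylor_model p f x y) + S_fun \<psi> x \<gamma> y"

(* Minimal values as infima in the extended reals, so that no attainment has to be assumed:
   the value is the minimum whenever that exists, and it is never an unspecified real. *)
definition F_star ::
    "('a::real_vector \<Rightarrow> real) \<Rightarrow> ('a \<Rightarrow> ereal) \<Rightarrow> 'a \<Rightarrow> real \<Rightarrow> ereal" where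
  "F_star f \<psi> x \<gamma> = (INF y \<in> contracted_set \<psi> x \<gamma>. F_fun f \<psi> x \<gamma> y)"

definition M_star ::
    "nat \<Rightarrow> ('a::real_normed_vector \<Rightarrow> real) \<Rightarrow> ('a \<Rightarrow> ereal) \<Rightarrow> 'a \<Rightarrow> real \<Rightarrow> ereal" where
  "M_star p f \<psi> x \<gamma> = (INF y \<in> contracted_set \<psi> x \<gamma>. M_fun p f \<psi> x \<gamma> y)"

end

theory Submission
  imports Defs
begin

text \<open>
  On the contracted set every point has the form \<open>y = x\<^sub>k + \<gamma> (v - x\<^sub>k)\<close>, so by homogeneity of the
  directional derivatives \<open>f\<close> differs from its Taylor model at \<open>y\<close> by at most \<open>\<Delta> \<gamma> ^ (p + 1)\<close>.
  Hence \<open>F\<^sub>k\<close> and \<open>M\<^sub>k\<close> are uniformly close, and passing from \<open>M\<^sub>k\<close> to \<open>F\<^sub>k\<close> costs this error twice: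
  once at \<open>xbar\<close> and once at the competitor.
\<close>

text \<open>
  \<open>deriv\<close> has an arbitrary value at points of non-differentiability, so homogeneity needs the
  smoothness assumption; the factor \<open>a\<close> absorbs the powers of \<open>c\<close> during the induction.
\<close>

lemma funpow_deriv_scale:
  fixes f :: "'a::euclidean_space \<Rightarrow> real"
  assumes "cont_diff_at n f x" "i \<le> n"
  shows "(deriv ^^ i) (\<lambda>s. a * f (x + s *\<^sub>R (c *\<^sub>R h))) 0
           = a * c ^ i * (deriv ^^ i) (\<lambda>s. f (x + s *\<^sub>R h)) 0"
  using assms
proof (induction i arbitrary: n f a)
  case (Suc i)
  then obtain m where n: "n = Suc m" "i \<le> m"
    by (cases n) auto
  define f' where "f' = (\<lambda>y. frechet_derivative f (at y) h)"
  have diff: "\<forall>\<^sub>F y in nhds x. f differentiable (at y)" and f': "cont_diff_at m f' x"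
    using Suc.prems(1) n by (auto simp: f'_def)
  \<comment> \<open>Equality near \<open>0\<close>, not only at \<open>0\<close>, is what iterated
    \<open>deriv\<close> respects. The free \<open>b\<close> and \<open>d\<close> let the fact serve
    both the scaled line (\<open>a\<close>, \<open>c\<close>) and the unscaled one
    (\<open>1\<close>, \<open>1\<close>).\<close>
  have *: "\<forall>\<^sub>F s in nhds 0.
      deriv (\<lambda>s. b * f (x + s *\<^sub>R (d *\<^sub>R h))) s = (b * d) * f' (x + s *\<^sub>R (d *\<^sub>R h))" for b d
  proof -
    have "filterlim (\<lambda>s::real. x + s *\<^sub>R (d *\<^sub>R h)) (nhds (x + 0 *\<^sub>R (d *\<^sub>R h))) (nhds 0)"
      by (intro tendsto_intros filterlim_ident)
    then have "\<forall>\<^sub>F s in nhds 0. f differentiable (at (x + s *\<^sub>R (d *\<^sub>R h)))"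
      using diff by (auto simp: filterlim_iff)
    then show ?thesis
    proof eventually_elim
      case (elim s)
      let ?D = "frechet_derivative f (at (x + s *\<^sub>R (d *\<^sub>R h)))"
      have D: "(f has_derivative ?D) (at (x + s *\<^sub>R (d *\<^sub>R h)))"
        using elim frechet_derivative_works by blast
      interpret bounded_linear ?D
        using D by (rule has_derivative_bounded_linear)
      have "((\<lambda>s. x + s *\<^sub>R (d *\<^sub>R h)) has_derivative (\<lambda>u. u *\<^sub>R (d *\<^sub>R h))) (at s)"
        by (auto intro!: derivative_eq_intros)
      from has_derivative_compose[OF this D]
      have "((\<lambda>s. f (x + s *\<^sub>R (d *\<^sub>R h))) has_derivative (\<lambda>u. ?D (u *\<^sub>R (d *\<^sub>R h)))) (at s)" .
      then have "((\<lambda>s. b * f (x + s *\<^sub>R (d *\<^sub>R h))) has_derivative (\<lambda>u. b * ?D (u *\<^sub>R (d *\<^sub>R h)))) (at s)"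
        by (rule has_derivative_mult_right)
      then have "((\<lambda>s. b * f (x + s *\<^sub>R (d *\<^sub>R h))) has_field_derivative (b * d * ?D h)) (at s)"
        by (rule has_derivative_imp_has_field_derivative) (simp add: scale del: scaleR_scaleR)
      then show ?case
        by (simp add: f'_def DERIV_imp_deriv)
    qed
  qed
  \<comment> \<open>The innermost derivative is peeled off: \<open>f\<close> becomes
    \<open>f'\<close>, and the chain-rule factor \<open>c\<close> moves into the
    coefficient.\<close>
  have "(deriv ^^ Suc i) (\<lambda>s. a * f (x + s *\<^sub>R (c *\<^sub>R h))) 0
      = (deriv ^^ i) (\<lambda>s. (a * c) * f' (x + s *\<^sub>R (c *\<^sub>R h))) 0"
    unfolding funpow_Suc_right o_def by (rule higher_deriv_cong_ev[OF * refl])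
  also have "\<dots> = a * c * c ^ i * (deriv ^^ i) (\<lambda>s. f' (x + s *\<^sub>R h)) 0"
    by (rule Suc.IH[OF f' n(2)])
  also have "(deriv ^^ i) (\<lambda>s. f' (x + s *\<^sub>R h)) 0 = (deriv ^^ Suc i) (\<lambda>s. f (x + s *\<^sub>R h)) 0"
    unfolding funpow_Suc_right o_def
    by (rule higher_deriv_cong_ev[symmetric]) (use *[of 1 1] in simp_all)
  finally show ?case
    by (simp add: mult_ac)
qed simp

lemma dir_deriv_scaleR:
  fixes f :: "'a::euclidean_space \<Rightarrow> real"
  assumes "cont_diff_at n f x" "i \<le> n"
  shows "dir_deriv i f x (c *\<^sub>R h) = c ^ i * dir_deriv i f x h"
  using funpow_deriv_scale[OF assms, of 1 c h] by (simp add: dir_deriv_def)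

text \<open>Homogeneity pulls \<open>t ^ i\<close> out of each term, giving the polynomial that
  occurs inside \<open>Delta\<close>.\<close>

lemma taylor_model_segment:
  fixes f :: "'a::euclidean_space \<Rightarrow> real"
  assumes "cont_diff_at p f x"
  shows "taylor_model p f x (x + t *\<^sub>R h)
           = f x + (\<Sum>i=1..p. t ^ i / fact i * dir_deriv i f x h)"
  unfolding taylor_model_def
  by (auto intro!: sum.cong simp: dir_deriv_scaleR[OF assms])

text \<open>Each quotient is an absolute value times a positive factor. A point of \<open>Q\<close>
  supplies one, so the supremum cannot be the empty one, -\<infinity>.\<close>

lemma Delta_nonneg:
  assumes "Q \<noteq> {}"
  shows "0 \<le> Delta p Q f"
proof -
  obtain q where "q \<in> Q"
    using assms by auto
  then show ?thesis
    unfolding Delta_def by (intro SUP_upper2[of "(q, q, 1)"]) auto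
qed

text \<open>The triple \<open>(x, v, t)\<close> competes in the supremum; clearing the denominator
  gives the bound. A finite \<open>d\<close> keeps this in real arithmetic.\<close>

lemma taylor_model_error:
  fixes f :: "'a::euclidean_space \<Rightarrow> real"
  assumes "cont_diff_at p f x" "x \<in> Q" "v \<in> Q" "0 < t" "t \<le> 1"
    and D: "Delta p Q f = ereal d"
  shows "\<bar>f (x + t *\<^sub>R (v - x)) - taylor_model p f x (x + t *\<^sub>R (v - x))\<bar> \<le> d * t ^ (p + 1)"
proof -
  have "ereal (1 / t ^ (p + 1) *
      \<bar>f (x + t *\<^sub>R (v - x)) - f x
        - (\<Sum>i=1..p. t ^ i / fact i * dir_deriv i f x (v - x))\<bar>) \<le> Delta p Q f"
    unfolding Delta_def using assms by (intro SUP_upper2[of "(x, v, t)"]) auto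
  then have "1 / t ^ (p + 1) *
      \<bar>f (x + t *\<^sub>R (v - x)) - taylor_model p f x (x + t *\<^sub>R (v - x))\<bar> \<le> d"
    by (simp add: D taylor_model_segment[OF assms(1)] diff_diff_eq)
  then show ?thesis
    using \<open>0 < t\<close> by (simp add: divide_le_eq)
qed

theorem theorem3:
  fixes f :: "'a::euclidean_space \<Rightarrow> real"
    and \<psi> :: "'a \<Rightarrow> ereal"
    and p :: nat
    and x\<^sub>k xbar vbar :: 'a
    and \<gamma> \<xi> c :: real
  assumes "proper_closed_convex \<psi>"
    and "bounded (edom \<psi>)"
    and "p \<ge> 1"
    and "convex_on (edom \<psi>) f"
    and "\<forall>x\<in>edom \<psi>. cont_diff_at p f x"
    and "x\<^sub>k \<in> edom \<psi>"
    and "0 < \<gamma>" and "\<gamma> \<le> 1"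
    and "vbar \<in> edom \<psi>"
    and "xbar = (1 - \<gamma>) *\<^sub>R x\<^sub>k + \<gamma> *\<^sub>R vbar"
    and "M_fun p f \<psi> x\<^sub>k \<gamma> xbar - M_star p f \<psi> x\<^sub>k \<gamma> \<le> ereal \<xi>"
    and "c \<ge> 0"
    and "\<xi> \<le> c * \<gamma> ^ (p + 1)"
  shows "F_fun f \<psi> x\<^sub>k \<gamma> xbar - F_star f \<psi> x\<^sub>k \<gamma>
           \<le> (ereal c + 2 * Delta p (edom \<psi>) f) * ereal (\<gamma> ^ (p + 1))"
proof -
  let ?Q = "edom \<psi>" and ?g = "\<gamma> ^ (p + 1)"
  let ?F = "F_fun f \<psi> x\<^sub>k \<gamma>" and ?M = "M_fun p f \<psi> x\<^sub>k \<gamma>"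
  let ?y = "\<lambda>v. x\<^sub>k + \<gamma> *\<^sub>R (v - x\<^sub>k)"
  have point: "(1 - \<gamma>) *\<^sub>R x\<^sub>k + \<gamma> *\<^sub>R v = ?y v" for v
    by (simp add: algebra_simps)
  have g: "0 < ?g"
    using \<open>0 < \<gamma>\<close> by simp
  have D0: "0 \<le> Delta p ?Q f"
    using \<open>x\<^sub>k \<in> ?Q\<close> by (intro Delta_nonneg) auto
  show ?thesis
  proof (cases "Delta p ?Q f = \<infinity>")
    \<comment> \<open>The right-hand side is \<infinity>, as \<open>?g\<close> is positive and so
      the product is not the convention \<open>0 * \<infinity> = 0\<close>.\<close>
    case True
    then show ?thesis
      using g \<open>0 < \<gamma>\<close> by auto
  next
    case False
    then obtain d where d: "Delta p ?Q f = ereal d"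
      using D0 by (cases "Delta p ?Q f") auto
    \<comment> \<open>Properness makes \<open>\<psi>\<close> finite on its domain, so there both
      objectives become real functions of \<open>v\<close>.\<close>
    define r where "r = (\<lambda>v. real_of_ereal (\<psi> v))"
    define m where "m = (\<lambda>v. taylor_model p f x\<^sub>k (?y v) + \<gamma> * r v)"
    define \<phi> where "\<phi> = (\<lambda>v. f (?y v) + \<gamma> * r v)"
    have "\<psi> v = ereal (r v)" if "v \<in> ?Q" for v
      using assms(1) that unfolding proper_closed_convex_def edom_def r_def
      by (cases "\<psi> v") auto
    then have S: "S_fun \<psi> x\<^sub>k \<gamma> (?y v) = ereal (\<gamma> * r v)" if "v \<in> ?Q" for v
      using that \<open>0 < \<gamma>\<close> by (simp add: S_fun_def)
    have F: "?F (?y v) = ereal (\<phi> v)" and M: "?M (?y v) = ereal (m v)" if "v \<in> ?Q" for v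
      by (simp_all add: F_fun_def M_fun_def S[OF that] \<phi>_def m_def)
    have close: "\<bar>\<phi> v - m v\<bar> \<le> d * ?g" if "v \<in> ?Q" for v
      using taylor_model_error[OF _ \<open>x\<^sub>k \<in> ?Q\<close> that \<open>0 < \<gamma>\<close> \<open>\<gamma> \<le> 1\<close> d] assms(5,6)
      by (simp add: \<phi>_def m_def)
    have xbar: "xbar = ?y vbar"
      using assms(10) point by simp
    have M_le: "M_star p f \<psi> x\<^sub>k \<gamma> \<le> ereal (m v)" if "v \<in> ?Q" for v
      unfolding M_star_def contracted_set_def
      by (rule INF_lower2[of "?y v"]) (use that M point in auto)
    have gap: "ereal (m vbar) - M_star p f \<psi> x\<^sub>k \<gamma> \<le> ereal \<xi>"
      using assms(11) M[OF \<open>vbar \<in> ?Q\<close>] by (simp add: xbar)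
    \<comment> \<open>Here \<open>M_star\<close> is finite: -\<infinity> would make the gap
      infinite, and \<infinity> contradicts \<open>M_le\<close>.\<close>
    have near_min: "m vbar - \<xi> \<le> m v" if "v \<in> ?Q" for v
      using gap M_le[OF that] by (cases "M_star p f \<psi> x\<^sub>k \<gamma>") auto
    \<comment> \<open>Bounding the infimum from below by testing every competitor avoids any need
      for a minimizer.\<close>
    have "ereal (\<phi> vbar - (c + 2 * d) * ?g) \<le> F_star f \<psi> x\<^sub>k \<gamma>"
      unfolding F_star_def
    proof (rule INF_greatest)
      fix y
      assume "y \<in> contracted_set \<psi> x\<^sub>k \<gamma>"
      then obtain v where v: "v \<in> ?Q" "y = ?y v"
        unfolding contracted_set_def using point by auto
      \<comment> \<open>The chain is \<open>\<phi> vbar \<le> m vbar + d * ?g \<le> m v + \<xi> + d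
        * ?g \<le> \<phi> v + \<xi> + 2 * d * ?g\<close>, with \<open>\<xi> \<le> c * ?g\<close>.
        Distributing leaves \<open>c * ?g\<close> and \<open>d * ?g\<close> as atoms for linear
        arithmetic.\<close>
      have "\<phi> vbar - (c + 2 * d) * ?g \<le> \<phi> v"
        using close[OF v(1)] close[OF \<open>vbar \<in> ?Q\<close>] near_min[OF v(1)] assms(13)
        unfolding distrib_right mult.assoc by linarith
      then show "ereal (\<phi> vbar - (c + 2 * d) * ?g) \<le> ?F y"
        using F[OF v(1)] v(2) by simp
    qed
    \<comment> \<open>The real lower bound excludes \<open>F_star\<close> being -\<infinity>; at
      \<infinity> the difference would be -\<infinity>, so the inequality survives.\<close>
    then have "ereal (\<phi> vbar) - F_star f \<psi> x\<^sub>k \<gamma> \<le> ereal ((c + 2 * d) * ?g)"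
      by (cases "F_star f \<psi> x\<^sub>k \<gamma>") auto
    then show ?thesis
      using F[OF \<open>vbar \<in> ?Q\<close>] d by (simp add: xbar)
  qed
qed

end
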